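(* Let $n\ge 2$ be an integer, let $N>0$ be a real number and put $\alpha=2N$. Let $P:\mathbb{R}^n\to\mathbb{R}$ be the Rosenbrock function, $\mathcal{S}_a$ the canonical dual feasible space, $P^d:\mathcal{S}_a\to\mathbb{R}$ the canonical dual function, and $\mathcal{S}_a^+\subset\mathcal{S}_a$ the subset defined in the context. Suppose that $\bar\varsigma=(\bar\varsigma_1,\dots,\bar\varsigma_{n-1})\in\mathcal{S}_a$ is a critical point of $P^d$ on $\mathcal{S}_a$, and let $\bar x=(\bar x_1,\dots,\bar x_n)\in\mathbb{R}^n$ be defined by $$\bar x_i=\frac{\bar\varsigma_{i-1}+2}{2(\bar\varsigma_i+1)},\quad i=1,\dots,n-1,\qquad \bar x_n=\bar x_{n-1}^2,$$ with the convention $\bar\varsigma_0=0$. If $\bar\varsigma\in\mathcal{S}_a^+$, then $\bar\varsigma$ is a global maximizer of $P^d$ on $\mathcal{S}_a^+$, the vector $\bar x$ is a global minimizer of $P$ on $\mathbb{R}^n$, and $$P(\bar x)=\min_{x\in\mathbb{R}^n}P(x)=\max_{\varsigma\in\mathcal{S}_a^+}P^d(\varsigma)=P^d(\bar\varsigma).$$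
   Context: For $x=(x_1,\dots,x_n)\in\mathbb{R}^n$ the Rosenbrock function is $$P(x)=\sum_{i=1}^{n-1}\left[(x_i-1)^2+\tfrac12\alpha\,(x_{i+1}-x_i^2)^2\right].$$ The canonical dual feasible space is $$\mathcal{S}_a=\{\varsigma\in\mathbb{R}^{n-1} : \varsigma_i+1\neq 0\ \text{for } i=1,\dots,n-2,\ \text{and } \varsigma_{n-1}=0\},$$ and $$\mathcal{S}_a^+=\{\varsigma\in\mathcal{S}_a : \varsigma_i+1>0\ \text{for all } i=1,\dots,n-1\}.$$ With the convention $\varsigma_0=0$, the canonical dual function on $\mathcal{S}_a$ is $$P^d(\varsigma)=n-1-\sum_{i=1}^{n-1}\left[\frac{(\varsigma_{i-1}+2)^2}{4(\varsigma_i+1)}+\tfrac12\alpha^{-1}\varsigma_i^2\right].$$ A critical point of $P^d$ on $\mathcal{S}_a$ is a point $\bar\varsigma\in\mathcal{S}_a$ at which $\partial P^d/\partial\varsigma_i=0$ for all $i=1,\dots,n-2$; that is, $\varsigma_{n-1}$ is fixed to be $0$ and $P^d$ is regarded as a function of the free variables $\varsigma_1,\dots,\varsigma_{n-2}$ (for $n=2$ the single point of $\mathcal{S}_a$ is a critical point). *)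

theory Defs
  imports Complex_Main "HOL-Library.FuncSet"
begin

text \<open>
  The dimension is a natural number used arithmetically, so a vector in \<open>\<real>\<close>^m is a function on
  the index set \<open>{1..m}\<close>, extensional (equal to \<open>undefined\<close> elsewhere) so that vectors and
  functions correspond one-to-one.
\<close>

definition vec_space :: "nat \<Rightarrow> (nat \<Rightarrow> real) set" where
  "vec_space m = {1..m} \<rightarrow>\<^sub>E UNIV"

definition rosenbrock :: "real \<Rightarrow> nat \<Rightarrow> (nat \<Rightarrow> real) \<Rightarrow> real" where
  "rosenbrock \<alpha> n x =
     (\<Sum>i = 1..n - 1. (x i - 1)\<^sup>2 + 1/2 * \<alpha> * (x (i + 1) - (x i)\<^sup>2)\<^sup>2)"

definition dual_space :: "nat \<Rightarrow> (nat \<Rightarrow> real) set" where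
  "dual_space n =
     {\<sigma> \<in> vec_space (n - 1). (\<forall>i\<in>{1..n - 2}. \<sigma> i + 1 \<noteq> 0) \<and> \<sigma> (n - 1) = 0}"

definition dual_space_pos :: "nat \<Rightarrow> (nat \<Rightarrow> real) set" where
  "dual_space_pos n = {\<sigma> \<in> dual_space n. \<forall>i\<in>{1..n - 1}. \<sigma> i + 1 > 0}"

text \<open>
  The vector \<open>\<sigma>\<close> has no component at index 0; \<open>zero_ext\<close> supplies the convention that the
  component at 0 is 0.
\<close>

definition zero_ext :: "(nat \<Rightarrow> real) \<Rightarrow> nat \<Rightarrow> real" where
  "zero_ext \<sigma> i = (if i = 0 then 0 else \<sigma> i)"

definition canonical_dual :: "real \<Rightarrow> nat \<Rightarrow> (nat \<Rightarrow> real) \<Rightarrow> real" where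
  "canonical_dual \<alpha> n \<sigma> =
     real n - 1 -
     (\<Sum>i = 1..n - 1. (zero_ext \<sigma> (i - 1) + 2)\<^sup>2 / (4 * (\<sigma> i + 1))
                      + 1/2 * inverse \<alpha> * (\<sigma> i)\<^sup>2)"

text \<open>
  Only the components \<open>1..n - 2\<close> are free variables, hence only the corresponding partial
  derivatives are required to vanish; for \<open>n = 2\<close> there are none.  Varying one of these
  components slightly does not leave \<open>dual_space n\<close>.
\<close>

definition dual_critical_point :: "real \<Rightarrow> nat \<Rightarrow> (nat \<Rightarrow> real) \<Rightarrow> bool" where
  "dual_critical_point \<alpha> n \<sigma> \<longleftrightarrow>
     \<sigma> \<in> dual_space n \<and>
     (\<forall>i\<in>{1..n - 2}.
        ((\<lambda>t. canonical_dual \<alpha> n (\<sigma>(i := t))) has_real_derivative 0) (at (\<sigma> i)))"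

end

theory Submission
  imports Defs
begin

text \<open>
  Completing squares in \<open>y\<^sub>i\<close> and in \<open>\<tau>\<^sub>i\<close> writes \<open>P(y) - P\<^sup>d(\<tau>)\<close> as a sum of squares with positive
  weights; the cross terms \<open>\<tau>\<^sub>i\<^sub>-\<^sub>1 y\<^sub>i - \<tau>\<^sub>i y\<^sub>i\<^sub>+\<^sub>1\<close> telescope to zero since the components of \<open>\<tau>\<close> at \<open>0\<close> and
  \<open>n - 1\<close> vanish.  This is weak duality.  At \<open>(x, \<sigma>)\<close> the squares from \<open>y\<^sub>i\<close> vanish by the choice of \<open>x\<close>,
  and the remaining ones because their bases \<open>x\<^sub>i\<^sup>2 - x\<^sub>i\<^sub>+\<^sub>1 - \<sigma>\<^sub>i / \<alpha>\<close> are the partial derivatives of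
  \<open>P\<^sup>d\<close> for \<open>i \<le> n - 2\<close>, and zero by the definition of \<open>x\<^sub>n\<close> for \<open>i = n - 1\<close>.
\<close>

text \<open>Here \<open>s\<close>, \<open>t\<close>, \<open>y\<close>, \<open>y'\<close> stand for
  the components of \<tau> at i - 1 and i and of y at i and i + 1. The two squares absorb every
  quadratic term, and what is left over is the linear cross term \<open>s * y - t * y'\<close>,
  shaped to telescope.\<close>

lemma duality_gap_summand:
  fixes y y' s t \<alpha> :: real
  assumes "\<alpha> \<noteq> 0" and "t + 1 \<noteq> 0"
  shows "(y - 1)\<^sup>2 + 1/2 * \<alpha> * (y' - y\<^sup>2)\<^sup>2
      = 1 - ((s + 2)\<^sup>2 / (4 * (t + 1)) + 1/2 * inverse \<alpha> * t\<^sup>2)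
        + ((t + 1) * (y - (s + 2) / (2 * (t + 1)))\<^sup>2 + 1/2 * \<alpha> * (y\<^sup>2 - y' - t / \<alpha>)\<^sup>2)
        + (s * y - t * y')"
proof -
  have primal: "(t + 1) * (y - (s + 2) / (2 * (t + 1)))\<^sup>2
      = (t + 1) * y\<^sup>2 - (s + 2) * y + (s + 2)\<^sup>2 / (4 * (t + 1))"
  proof -
    \<comment> \<open>Writing \<open>s + 2\<close> as \<open>2 * u * k\<close> clears the
      denominators, so that a polynomial identity remains.\<close>
    define u where "u = t + 1"
    define k where "k = (s + 2) / (2 * u)"
    have "u \<noteq> 0" using assms(2) by (simp add: u_def)
    then have s: "s + 2 = 2 * u * k" by (simp add: k_def)
    have "(s + 2)\<^sup>2 / (4 * u) = u * k\<^sup>2"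
      unfolding s using \<open>u \<noteq> 0\<close> by (simp add: power2_eq_square)
    then show ?thesis
      unfolding u_def[symmetric] k_def[symmetric] unfolding s
      by (simp add: power2_eq_square algebra_simps)
  qed
  have dual: "1/2 * \<alpha> * (y\<^sup>2 - y' - t / \<alpha>)\<^sup>2
      = 1/2 * \<alpha> * (y' - y\<^sup>2)\<^sup>2 - t * (y\<^sup>2 - y') + 1/2 * inverse \<alpha> * t\<^sup>2"
  proof -
    \<comment> \<open>The same device: \<open>t = \<alpha> * q\<close> removes the division by
      \<alpha>.\<close>
    define q where "q = t / \<alpha>"
    have t: "t = \<alpha> * q" using assms(1) by (simp add: q_def)
    have "inverse \<alpha> * t\<^sup>2 = \<alpha> * q\<^sup>2"
      using assms(1) by (simp add: t power2_eq_square)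
    then show ?thesis
      unfolding q_def[symmetric] by (simp add: t power2_eq_square algebra_simps)
  qed
  show ?thesis
    unfolding primal dual by (simp add: power2_eq_square algebra_simps)
qed

text \<open>The constants 1 of the summands add up to n - 1, the constant term of
  \<open>canonical_dual\<close>. Being an exact identity, it serves both the inequality and the case
  of equality.\<close>

lemma duality_gap:
  assumes n: "n \<ge> 2" and \<alpha>: "\<alpha> \<noteq> 0" and \<tau>: "\<tau> \<in> dual_space_pos n"
  shows "rosenbrock \<alpha> n y = canonical_dual \<alpha> n \<tau> +
    (\<Sum>i = 1..n - 1. (\<tau> i + 1) * (y i - (zero_ext \<tau> (i - 1) + 2) / (2 * (\<tau> i + 1)))\<^sup>2
                     + 1/2 * \<alpha> * ((y i)\<^sup>2 - y (i + 1) - \<tau> i / \<alpha>)\<^sup>2)"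
proof -
  have "rosenbrock \<alpha> n y =
    (\<Sum>i = 1..n - 1.
        1 - ((zero_ext \<tau> (i - 1) + 2)\<^sup>2 / (4 * (\<tau> i + 1)) + 1/2 * inverse \<alpha> * (\<tau> i)\<^sup>2)
        + ((\<tau> i + 1) * (y i - (zero_ext \<tau> (i - 1) + 2) / (2 * (\<tau> i + 1)))\<^sup>2
           + 1/2 * \<alpha> * ((y i)\<^sup>2 - y (i + 1) - \<tau> i / \<alpha>)\<^sup>2)
        + (zero_ext \<tau> (i - 1) * y i - \<tau> i * y (i + 1)))"
    unfolding rosenbrock_def
  proof (rule sum.cong[OF refl])
    fix i assume "i \<in> {1..n - 1}"
    with \<tau> have "\<tau> i + 1 \<noteq> 0" by (force simp: dual_space_pos_def)
    then show "(y i - 1)\<^sup>2 + 1/2 * \<alpha> * (y (i + 1) - (y i)\<^sup>2)\<^sup>2 =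
        1 - ((zero_ext \<tau> (i - 1) + 2)\<^sup>2 / (4 * (\<tau> i + 1)) + 1/2 * inverse \<alpha> * (\<tau> i)\<^sup>2)
        + ((\<tau> i + 1) * (y i - (zero_ext \<tau> (i - 1) + 2) / (2 * (\<tau> i + 1)))\<^sup>2
           + 1/2 * \<alpha> * ((y i)\<^sup>2 - y (i + 1) - \<tau> i / \<alpha>)\<^sup>2)
        + (zero_ext \<tau> (i - 1) * y i - \<tau> i * y (i + 1))"
      by (rule duality_gap_summand[OF \<alpha>])
  qed
  moreover have "(\<Sum>i = 1..n - 1. zero_ext \<tau> (i - 1) * y i - \<tau> i * y (i + 1)) = 0"
  proof -
    \<comment> \<open>A general upper bound m makes induction possible; \<open>zero_ext\<close> on
      the right also covers the empty sum at m = 0.\<close>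
    have "(\<Sum>i = 1..m. zero_ext \<tau> (i - 1) * y i - \<tau> i * y (i + 1))
        = - (zero_ext \<tau> m * y (m + 1))" for m
      by (induction m) (simp_all add: zero_ext_def)
    moreover have "zero_ext \<tau> (n - 1) = 0"
      using \<tau> by (auto simp: zero_ext_def dual_space_pos_def dual_space_def)
    ultimately show ?thesis by simp
  qed
  ultimately show ?thesis
    using n by (simp add: canonical_dual_def sum.distrib sum_subtractf of_nat_diff)
qed

lemma weak_duality:
  assumes "n \<ge> 2" and "\<alpha> > 0" and \<tau>: "\<tau> \<in> dual_space_pos n"
  shows "canonical_dual \<alpha> n \<tau> \<le> rosenbrock \<alpha> n y"
proof -
  have "0 \<le> (\<Sum>i = 1..n - 1. (\<tau> i + 1) * (y i - (zero_ext \<tau> (i - 1) + 2) / (2 * (\<tau> i + 1)))\<^sup>2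
                     + 1/2 * \<alpha> * ((y i)\<^sup>2 - y (i + 1) - \<tau> i / \<alpha>)\<^sup>2)"
  proof (rule sum_nonneg)
    fix i assume "i \<in> {1..n - 1}"
    with \<tau> have "\<tau> i + 1 > 0" by (auto simp: dual_space_pos_def)
    with \<open>\<alpha> > 0\<close> show "0 \<le> (\<tau> i + 1) * (y i - (zero_ext \<tau> (i - 1) + 2) / (2 * (\<tau> i + 1)))\<^sup>2
                     + 1/2 * \<alpha> * ((y i)\<^sup>2 - y (i + 1) - \<tau> i / \<alpha>)\<^sup>2"
      by simp
  qed
  then show ?thesis
    using duality_gap[of n \<alpha> \<tau> y] assms by simp
qed

text \<open>The variable at index i occurs in two summands only: in summand i, and as the
  predecessor in the numerator of summand i + 1. The two fractions in the result are the prescribed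
  values of x at i and i + 1.\<close>

lemma canonical_dual_partial_derivative:
  assumes i: "i \<in> {1..n - 2}"
    and nz: "\<sigma> i + 1 \<noteq> 0"
  shows "((\<lambda>t. canonical_dual \<alpha> n (\<sigma>(i := t))) has_real_derivative
    ((zero_ext \<sigma> (i - 1) + 2) / (2 * (\<sigma> i + 1)))\<^sup>2 - \<sigma> i / \<alpha>
      - (\<sigma> i + 2) / (2 * (\<sigma> (i + 1) + 1))) (at (\<sigma> i))"
proof -
  \<comment> \<open>\<open>A\<close> and \<open>B\<close> are the derivatives of summands i and i +
    1; their signs flip at the end because \<open>canonical_dual\<close> subtracts the sum.\<close>
  define A where "A = \<sigma> i / \<alpha> - ((zero_ext \<sigma> (i - 1) + 2) / (2 * (\<sigma> i + 1)))\<^sup>2"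
  define B where "B = (\<sigma> i + 2) / (2 * (\<sigma> (i + 1) + 1))"
  define f where "f j t = (zero_ext (\<sigma>(i := t)) (j - 1) + 2)\<^sup>2 / (4 * ((\<sigma>(i := t)) j + 1))
      + 1/2 * inverse \<alpha> * ((\<sigma>(i := t)) j)\<^sup>2" for j t
  have summand: "(f j has_real_derivative
      (if j = i then A else 0) + (if j = i + 1 then B else 0)) (at (\<sigma> i))"
    if "j \<in> {1..n - 1}" for j
  proof -
    consider "j = i" | "j = i + 1" | "j \<noteq> i" "j \<noteq> i + 1" by blast
    then show ?thesis
    proof cases
      case 1
      \<comment> \<open>Since i is at least 1, the index i - 1 differs from i, so the update does
        not reach the numerator.\<close>
      have "zero_ext (\<sigma>(i := t)) (i - 1) = zero_ext \<sigma> (i - 1)" for t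
        using i by (auto simp: zero_ext_def)
      then have "f j = (\<lambda>t. (zero_ext \<sigma> (i - 1) + 2)\<^sup>2 / (4 * (t + 1)) + 1/2 * inverse \<alpha> * t\<^sup>2)"
        by (simp add: f_def 1 fun_eq_iff)
      moreover have "((\<lambda>t. (zero_ext \<sigma> (i - 1) + 2)\<^sup>2 / (4 * (t + 1)) + 1/2 * inverse \<alpha> * t\<^sup>2)
          has_real_derivative A) (at (\<sigma> i))"
      proof -
        define u where "u = \<sigma> i + 1"
        define c where "c = zero_ext \<sigma> (i - 1) + 2"
        have "u \<noteq> 0" using nz by (simp add: u_def)
        have "((\<lambda>t. 4 * (t + 1)) has_real_derivative 4) (at (\<sigma> i))"
          by (auto intro!: derivative_eq_intros)
        then have "((\<lambda>t. c\<^sup>2 / (4 * (t + 1))) has_real_derivative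
            (0 * (4 * u) - c\<^sup>2 * 4) / ((4 * u) * (4 * u))) (at (\<sigma> i))"
          unfolding u_def using nz by (intro DERIV_divide DERIV_const) auto
        moreover have "((\<lambda>t. 1/2 * inverse \<alpha> * t\<^sup>2) has_real_derivative \<sigma> i / \<alpha>) (at (\<sigma> i))"
          using DERIV_cmult[OF DERIV_pow[of 2 "\<sigma> i"], of "1/2 * inverse \<alpha>"]
          by (simp add: inverse_eq_divide)
        ultimately have "((\<lambda>t. c\<^sup>2 / (4 * (t + 1)) + 1/2 * inverse \<alpha> * t\<^sup>2) has_real_derivative
            (0 * (4 * u) - c\<^sup>2 * 4) / ((4 * u) * (4 * u)) + \<sigma> i / \<alpha>) (at (\<sigma> i))"
          by (rule DERIV_add)
        moreover have "(0 * (4 * u) - c\<^sup>2 * 4) / ((4 * u) * (4 * u)) + \<sigma> i / \<alpha> = A"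
          using \<open>u \<noteq> 0\<close> unfolding A_def c_def[symmetric] u_def[symmetric]
          by (simp add: power_divide power2_eq_square)
        ultimately show ?thesis by (simp only: c_def)
      qed
      ultimately show ?thesis using 1 by simp
    next
      case 2
      then have "f j = (\<lambda>t. (t + 2)\<^sup>2 / (4 * (\<sigma> (i + 1) + 1)) + 1/2 * inverse \<alpha> * (\<sigma> (i + 1))\<^sup>2)"
        using i by (simp add: f_def fun_eq_iff zero_ext_def)
      moreover have "((\<lambda>t. (t + 2)\<^sup>2 / (4 * (\<sigma> (i + 1) + 1)) + 1/2 * inverse \<alpha> * (\<sigma> (i + 1))\<^sup>2)
          has_real_derivative B) (at (\<sigma> i))"
      proof -
        define d where "d = \<sigma> (i + 1) + 1"
        have "((\<lambda>t. (t + 2)\<^sup>2) has_real_derivative 2 * (\<sigma> i + 2)) (at (\<sigma> i))"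
          by (auto intro!: derivative_eq_intros)
        then have "((\<lambda>t. (t + 2)\<^sup>2 / (4 * d) + 1/2 * inverse \<alpha> * (\<sigma> (i + 1))\<^sup>2)
            has_real_derivative 2 * (\<sigma> i + 2) / (4 * d) + 0) (at (\<sigma> i))"
          by (intro DERIV_add DERIV_cdivide DERIV_const)
        moreover have "2 * (\<sigma> i + 2) / (4 * d) + 0 = B"
          unfolding B_def d_def[symmetric] by (simp add: divide_simps)
        ultimately show ?thesis by (simp only: d_def)
      qed
      ultimately show ?thesis using 2 by simp
    next
      case 3
      moreover from this that have "zero_ext (\<sigma>(i := t)) (j - 1) = zero_ext \<sigma> (j - 1)" for t
        by (auto simp: zero_ext_def)
      ultimately have "f j = (\<lambda>_. (zero_ext \<sigma> (j - 1) + 2)\<^sup>2 / (4 * (\<sigma> j + 1))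
          + 1/2 * inverse \<alpha> * (\<sigma> j)\<^sup>2)"
        by (simp add: f_def fun_eq_iff)
      with 3 show ?thesis by simp
    qed
  qed
  have "((\<lambda>t. \<Sum>j = 1..n - 1. f j t) has_real_derivative
      (\<Sum>j = 1..n - 1. (if j = i then A else 0) + (if j = i + 1 then B else 0))) (at (\<sigma> i))"
    by (rule DERIV_sum) (rule summand)
  \<comment> \<open>Both i and i + 1 lie in the range of summation because i \<le> n - 2.\<close>
  moreover have "(\<Sum>j = 1..n - 1. (if j = i then A else 0) + (if j = i + 1 then B else 0)) = A + B"
    using i by (auto simp: sum.distrib)
  ultimately have "((\<lambda>t. real n - 1 - (\<Sum>j = 1..n - 1. f j t)) has_real_derivative 0 - (A + B))
      (at (\<sigma> i))"
    by (intro DERIV_diff DERIV_const) simp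
  then show ?thesis
    by (simp add: canonical_dual_def f_def A_def B_def)
qed

lemma strong_duality:
  assumes n: "n \<ge> 2" and \<alpha>: "\<alpha> > 0"
    and crit: "dual_critical_point \<alpha> n \<sigma>" and \<sigma>: "\<sigma> \<in> dual_space_pos n"
    and x: "\<forall>i\<in>{1..n - 1}. x i = (zero_ext \<sigma> (i - 1) + 2) / (2 * (\<sigma> i + 1))"
    and xn: "x n = (x (n - 1))\<^sup>2"
  shows "rosenbrock \<alpha> n x = canonical_dual \<alpha> n \<sigma>"
proof -
  \<comment> \<open>This is the relation between optimal primal and dual variables:
    \<open>\<sigma> i\<close> equals \<alpha> times
    \<open>(x i)\<^sup>2 - x (i + 1)\<close>.\<close>
  have dual: "(x i)\<^sup>2 - x (i + 1) - \<sigma> i / \<alpha> = 0" if i: "i \<in> {1..n - 1}" for i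
  proof (cases "i = n - 1")
    case True
    with n \<sigma> xn show ?thesis by (simp add: dual_space_pos_def dual_space_def)
  next
    case False
    with i have i2: "i \<in> {1..n - 2}" by auto
    have nz: "\<sigma> i + 1 \<noteq> 0" using \<sigma> i by (force simp: dual_space_pos_def)
    have "((zero_ext \<sigma> (i - 1) + 2) / (2 * (\<sigma> i + 1)))\<^sup>2 - \<sigma> i / \<alpha>
        - (\<sigma> i + 2) / (2 * (\<sigma> (i + 1) + 1)) = 0"
      \<comment> \<open>Criticality gives the derivative 0, and uniqueness of derivatives equates it
        with the explicit formula.\<close>
      using DERIV_unique[OF canonical_dual_partial_derivative[where \<sigma> = \<sigma> and \<alpha> = \<alpha>, OF i2 nz]]
        crit i2 unfolding dual_critical_point_def by blast
    moreover have "x i = (zero_ext \<sigma> (i - 1) + 2) / (2 * (\<sigma> i + 1))"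
      using x i by blast
    moreover have "x (i + 1) = (\<sigma> i + 2) / (2 * (\<sigma> (i + 1) + 1))"
    proof -
      have "i + 1 \<in> {1..n - 1}" using i2 by auto
      then show ?thesis using x i2 by (simp add: zero_ext_def)
    qed
    ultimately show ?thesis by simp
  qed
  have "(\<Sum>i = 1..n - 1. (\<sigma> i + 1) * (x i - (zero_ext \<sigma> (i - 1) + 2) / (2 * (\<sigma> i + 1)))\<^sup>2
      + 1/2 * \<alpha> * ((x i)\<^sup>2 - x (i + 1) - \<sigma> i / \<alpha>)\<^sup>2) = 0"
  proof (rule sum.neutral, rule ballI)
    fix i assume i: "i \<in> {1..n - 1}"
    then have "x i - (zero_ext \<sigma> (i - 1) + 2) / (2 * (\<sigma> i + 1)) = 0"
      using x by (metis diff_self)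
    then show "(\<sigma> i + 1) * (x i - (zero_ext \<sigma> (i - 1) + 2) / (2 * (\<sigma> i + 1)))\<^sup>2
      + 1/2 * \<alpha> * ((x i)\<^sup>2 - x (i + 1) - \<sigma> i / \<alpha>)\<^sup>2 = 0"
      unfolding dual[OF i] by (simp only: zero_power2 mult_zero_right add_0)
  qed
  then show ?thesis
    using duality_gap[OF n less_imp_neq[OF \<alpha>, symmetric] \<sigma>, of x] by linarith
qed

theorem theorem2:
  fixes n :: nat and N \<alpha> :: real and \<sigma> x :: "nat \<Rightarrow> real"
  assumes "n \<ge> 2" and "N > 0" and "\<alpha> = 2 * N"
    and "dual_critical_point \<alpha> n \<sigma>"
    and "x \<in> vec_space n"
    and "\<forall>i\<in>{1..n - 1}. x i = (zero_ext \<sigma> (i - 1) + 2) / (2 * (\<sigma> i + 1))"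
    and "x n = (x (n - 1))\<^sup>2"
    and "\<sigma> \<in> dual_space_pos n"
  shows "is_arg_max (canonical_dual \<alpha> n) (\<lambda>\<tau>. \<tau> \<in> dual_space_pos n) \<sigma>
    \<and> is_arg_min (rosenbrock \<alpha> n) (\<lambda>y. y \<in> vec_space n) x
    \<and> rosenbrock \<alpha> n x = (LEAST v. v \<in> rosenbrock \<alpha> n ` vec_space n)
    \<and> (LEAST v. v \<in> rosenbrock \<alpha> n ` vec_space n)
        = (GREATEST v. v \<in> canonical_dual \<alpha> n ` dual_space_pos n)
    \<and> (GREATEST v. v \<in> canonical_dual \<alpha> n ` dual_space_pos n) = canonical_dual \<alpha> n \<sigma>"
proof -
  have \<alpha>: "\<alpha> > 0" using assms by simp
  note weak = weak_duality[OF \<open>n \<ge> 2\<close> \<alpha>]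
  have eq: "rosenbrock \<alpha> n x = canonical_dual \<alpha> n \<sigma>"
    using strong_duality assms \<alpha> by blast
  \<comment> \<open>Weak duality with the dual point fixed at \<sigma> gives minimality of x; with
    the primal point fixed at x it gives maximality of \<sigma>.\<close>
  have min: "rosenbrock \<alpha> n x \<le> rosenbrock \<alpha> n y" for y
    using weak[OF assms(8), of y] eq by simp
  have max: "canonical_dual \<alpha> n \<tau> \<le> canonical_dual \<alpha> n \<sigma>" if "\<tau> \<in> dual_space_pos n" for \<tau>
    using weak[OF that, of x] eq by simp
  have "is_arg_max (canonical_dual \<alpha> n) (\<lambda>\<tau>. \<tau> \<in> dual_space_pos n) \<sigma>"
    using assms(8) max by (force simp: is_arg_max_def not_less)
  moreover have "is_arg_min (rosenbrock \<alpha> n) (\<lambda>y. y \<in> vec_space n) x"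
    using assms(5) min by (auto simp: is_arg_min_def not_less)
  \<comment> \<open>The bounds are attained at x and at \<sigma>, so the least and the greatest
    value exist and are identified directly.\<close>
  moreover have "(LEAST v. v \<in> rosenbrock \<alpha> n ` vec_space n) = rosenbrock \<alpha> n x"
    using assms(5) min by (intro Least_equality) auto
  moreover have "(GREATEST v. v \<in> canonical_dual \<alpha> n ` dual_space_pos n) = canonical_dual \<alpha> n \<sigma>"
    using assms(8) max by (intro Greatest_equality) auto
  ultimately show ?thesis
    using eq by simp
qed

end
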